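(* A connected graph $G$ is finitely separable if and only if it has a finitely separating spanning tree.
   Context: Two vertices of a graph $G$ are finitely separable if some finite set of edges of $G$ separates them in $G$; $G$ is finitely separable if every pair of its vertices is finitely separable. A spanning tree $T$ of $G$ is finitely separating if all its fundamental cuts are finite, i.e. for every edge $e\in E(T)$ with $T_1,T_2$ the components of $T-e$, the set $E_G(V(T_1),V(T_2))$ of edges of $G$ between $V(T_1)$ and $V(T_2)$ is finite. *)

theory Defs
  imports Main
begin

definition graph :: "'a set \<Rightarrow> 'a set set \<Rightarrow> bool" where
  "graph V E \<longleftrightarrow> E \<subseteq> {{x, y} | x y. x \<in> V \<and> y \<in> V \<and> x \<noteq> y}"

definition adj :: "'a set set \<Rightarrow> ('a \<times> 'a) set" where
  "adj E = {(x, y). {x, y} \<in> E}"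

definition reachable :: "'a set set \<Rightarrow> 'a \<Rightarrow> 'a \<Rightarrow> bool" where
  "reachable E u v \<longleftrightarrow> (u, v) \<in> (adj E)\<^sup>*"

definition connected_graph :: "'a set \<Rightarrow> 'a set set \<Rightarrow> bool" where
  "connected_graph V E \<longleftrightarrow> V \<noteq> {} \<and> (\<forall>u\<in>V. \<forall>v\<in>V. reachable E u v)"

definition separates :: "'a set set \<Rightarrow> 'a set set \<Rightarrow> 'a \<Rightarrow> 'a \<Rightarrow> bool" where
  "separates E F u v \<longleftrightarrow> \<not> reachable (E - F) u v"

definition finitely_separable_pair :: "'a set set \<Rightarrow> 'a \<Rightarrow> 'a \<Rightarrow> bool" where
  "finitely_separable_pair E u v \<longleftrightarrow> (\<exists>F. finite F \<and> F \<subseteq> E \<and> separates E F u v)"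

definition finitely_separable :: "'a set \<Rightarrow> 'a set set \<Rightarrow> bool" where
  "finitely_separable V E \<longleftrightarrow>
     (\<forall>u\<in>V. \<forall>v\<in>V. u \<noteq> v \<longrightarrow> finitely_separable_pair E u v)"

text \<open>Acyclic: no edge lies on a cycle, i.e. the endpoints of every edge
  are disconnected after deleting it.\<close>
definition acyclic_edges :: "'a set set \<Rightarrow> bool" where
  "acyclic_edges T \<longleftrightarrow> (\<forall>e\<in>T. \<forall>x y. e = {x, y} \<longrightarrow> \<not> reachable (T - {e}) x y)"

definition spanning_tree :: "'a set \<Rightarrow> 'a set set \<Rightarrow> 'a set set \<Rightarrow> bool" where
  "spanning_tree V E T \<longleftrightarrow> T \<subseteq> E \<and> connected_graph V T \<and> acyclic_edges T"

definition edges_between :: "'a set set \<Rightarrow> 'a set \<Rightarrow> 'a set \<Rightarrow> 'a set set" where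
  "edges_between E A B = {f \<in> E. \<exists>a\<in>A. \<exists>b\<in>B. f = {a, b}}"

definition comp_without :: "'a set \<Rightarrow> 'a set set \<Rightarrow> 'a set \<Rightarrow> 'a \<Rightarrow> 'a set" where
  "comp_without V T e x = {w \<in> V. reachable (T - {e}) x w}"

definition finitely_separating :: "'a set \<Rightarrow> 'a set set \<Rightarrow> 'a set set \<Rightarrow> bool" where
  "finitely_separating V E T \<longleftrightarrow>
     (\<forall>e\<in>T. \<forall>x y. e = {x, y} \<longrightarrow>
        finite (edges_between E (comp_without V T e x) (comp_without V T e y)))"

end

theory Submission
  imports Defs "HOL-Library.Countable_Set"
begin

text \<open>
  If \<open>T\<close> is finitely separating, the fundamental cut of any edge on the \<open>T\<close>-path between two
  vertices separates them.

  Conversely, a tree \<open>T\<close> spanning \<open>V\<close> is as desired once every \<open>e \<in> T\<close> lies in a finite cut of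
  \<open>G\<close> that meets \<open>T\<close> in \<open>e\<close> only. If \<open>G\<close> is countable, such a tree is built by exhausting the
  vertices: with each finite tree one keeps a finite edge set \<open>F\<close> whose deletion leaves one component
  per tree vertex, and the tree is only ever extended inside these components. For arbitrary \<open>G\<close>, a
  vertex \<open>u\<close> has only countably many neighbours in each component of \<open>G - u\<close>: that component is
  exhausted by countably many sets which are each separated from \<open>u\<close> by finitely many edges. Hence
  blocks are countable, and Zorn's lemma glues their trees together along cutvertices.
\<close>

subsection \<open>Reachability and cuts\<close>

lemma reachable_refl [simp]: "reachable E a a"
  by (simp add: reachable_def)

lemma reachable_trans [trans]: "reachable E a b \<Longrightarrow> reachable E b c \<Longrightarrow> reachable E a c"
  by (simp add: reachable_def)

lemma reachable_edge: "{a, b} \<in> E \<Longrightarrow> reachable E a b"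
  by (auto simp: reachable_def adj_def)

lemma reachable_step: "reachable E a b \<Longrightarrow> {b, c} \<in> E \<Longrightarrow> reachable E a c"
  using reachable_trans reachable_edge by metis

lemma reachable_sym: "reachable E a b \<Longrightarrow> reachable E b a"
proof -
  have "sym (adj E)" by (auto simp: sym_def adj_def insert_commute)
  then show "reachable E a b \<Longrightarrow> reachable E b a"
    unfolding reachable_def by (meson sym_rtrancl symD)
qed

lemma reachable_mono: "reachable E a b \<Longrightarrow> E \<subseteq> E' \<Longrightarrow> reachable E' a b"
  unfolding reachable_def using rtrancl_mono[of "adj E" "adj E'"] by (auto simp: adj_def)

lemma reachable_induct [consumes 1, case_names refl step]:
  assumes "reachable E a b" and "P a"
    and "\<And>b c. reachable E a b \<Longrightarrow> {b, c} \<in> E \<Longrightarrow> P b \<Longrightarrow> P c"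
  shows "P b"
  using assms(1) unfolding reachable_def
  by (induction rule: rtrancl_induct) (use assms(2,3) in \<open>auto simp: adj_def reachable_def\<close>)

lemma reachable_in_Union: "reachable T r y \<Longrightarrow> y \<in> insert r (\<Union>T)"
  by (induction rule: reachable_induct) auto

lemma graph_edgeD: "graph V E \<Longrightarrow> {a, b} \<in> E \<Longrightarrow> a \<in> V \<and> b \<in> V \<and> a \<noteq> b"
  unfolding graph_def by (auto simp: doubleton_eq_iff)

lemma graph_edgeE:
  assumes "graph V E" "e \<in> E"
  obtains a b where "e = {a, b}" "a \<in> V" "b \<in> V" "a \<noteq> b"
  using assms unfolding graph_def by blast

lemma graph_subset: "graph V E \<Longrightarrow> E' \<subseteq> E \<Longrightarrow> graph V E'"
  unfolding graph_def by blast

lemma graph_restrict: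
  assumes "graph V E" shows "graph Y (E \<inter> Pow Y)"
  unfolding graph_def
proof
  fix e assume e: "e \<in> E \<inter> Pow Y"
  then obtain a b where "e = {a, b}" "a \<noteq> b" using graph_edgeE[OF assms] by blast
  with e show "e \<in> {{x, y} |x y. x \<in> Y \<and> y \<in> Y \<and> x \<noteq> y}" by blast
qed

lemma reachable_in_graph: "reachable E a b \<Longrightarrow> graph V E \<Longrightarrow> a \<in> V \<Longrightarrow> b \<in> V"
  by (induction rule: reachable_induct) (auto dest: graph_edgeD)

text \<open>\<open>D\<close> may be any set of the type, not only a set of vertices. Hence
  \<open>- D\<close> yields the same cut, and either end of an edge can serve as the inner
  one.\<close>

definition cut :: "'a set set \<Rightarrow> 'a set \<Rightarrow> 'a set set" where
  "cut E D = {e \<in> E. \<exists>a\<in>D. \<exists>b. b \<notin> D \<and> e = {a, b}}"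

lemma cutI: "{a, b} \<in> E \<Longrightarrow> a \<in> D \<Longrightarrow> b \<notin> D \<Longrightarrow> {a, b} \<in> cut E D"
  unfolding cut_def by blast

lemma cut_restrict: "T \<subseteq> E \<Longrightarrow> cut T D = cut E D \<inter> T"
  unfolding cut_def by blast

lemma reachable_cut_free:
  assumes "reachable E a b" "a \<in> D" "cut E D = {}"
  shows "b \<in> D"
  using assms(1) by (induction rule: reachable_induct) (use assms cutI in fastforce)+

text \<open>No edge of \<open>H\<close> leaves \<open>D\<close>. So if \<open>H\<close> arises from
  \<open>E\<close> by deleting finitely many edges, \<open>D\<close> is one side of a finite
  cut.\<close>

lemma cut_reachable_set:
  assumes "H \<subseteq> E" and "D = {p. reachable H x p}"
  shows "cut E D \<subseteq> E - H"
  using assms unfolding cut_def by (auto intro: reachable_step)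

text \<open>Each return to \<open>t\<close> discards the walk so far; what follows the last visit
  starts with an edge at \<open>t\<close> and then avoids \<open>t\<close>.\<close>

lemma reachable_last_exit:
  assumes "reachable E t v" "t \<noteq> v"
  obtains p where "{t, p} \<in> E" "p \<noteq> t" "reachable {e \<in> E. t \<notin> e} p v"
proof -
  have "t = v \<or> (\<exists>p. {t, p} \<in> E \<and> p \<noteq> t \<and> reachable {e \<in> E. t \<notin> e} p v)"
    using assms(1)
  proof (induction rule: reachable_induct)
    case refl then show ?case by simp
  next
    case (step b c)
    show ?case
    proof (cases "c = t \<or> b = t")
      case True
      then show ?thesis using step reachable_refl by metis
    next
      case False
      then obtain p where p: "{t, p} \<in> E" "p \<noteq> t" "reachable {e \<in> E. t \<notin> e} p b"
        using step by blast
      moreover have "{b, c} \<in> {e \<in> E. t \<notin> e}" using step False by auto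
      ultimately show ?thesis using reachable_step by metis
    qed
  qed
  then show thesis using assms(2) that by blast
qed

text \<open>\<open>W\<close> stands in for the vertex set of a path; its size is the induction
  measure when a tree is extended along that path.\<close>

lemma reachable_finite_support:
  assumes "reachable E a b"
  shows "\<exists>W. finite W \<and> reachable {e \<in> E. e \<subseteq> W} a b"
  using assms
proof (induction rule: reachable_induct)
  case refl show ?case by (rule exI[of _ "{}"]) simp
next
  case (step b c)
  then obtain W where W: "finite W" "reachable {e \<in> E. e \<subseteq> W} a b" by blast
  have "reachable {e \<in> E. e \<subseteq> W \<union> {b, c}} a b" by (rule reachable_mono[OF W(2)]) auto
  moreover have "{b, c} \<in> {e \<in> E. e \<subseteq> W \<union> {b, c}}" using step by auto
  ultimately have "reachable {e \<in> E. e \<subseteq> W \<union> {b, c}} a c" by (rule reachable_step)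
  then show ?case using W(1) by (intro exI[of _ "W \<union> {b, c}"]) simp
qed

lemma separating_set_exists:
  assumes "finitely_separable V E" "u \<in> V" "v \<in> V" "u \<noteq> v"
  obtains F where "finite F" "\<not> reachable (E - F) u v"
  using assms unfolding finitely_separable_def finitely_separable_pair_def separates_def by blast

lemma finitely_separable_restrict:
  assumes "finitely_separable V E" "Y \<subseteq> V" "E' \<subseteq> E"
  shows "finitely_separable Y E'"
  unfolding finitely_separable_def finitely_separable_pair_def separates_def
proof (intro ballI impI)
  fix u v assume "u \<in> Y" "v \<in> Y" "u \<noteq> v"
  then obtain F where "finite F" "\<not> reachable (E - F) u v"
    using separating_set_exists[OF assms(1)] assms(2) by blast
  then have "finite (F \<inter> E')" "\<not> reachable (E' - F \<inter> E') u v"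
    using reachable_mono[of "E' - F \<inter> E'" u v "E - F"] assms(3) by auto
  then show "\<exists>F. finite F \<and> F \<subseteq> E' \<and> \<not> reachable (E' - F) u v" by blast
qed

subsection \<open>Trees all of whose edges have a finite cut\<close>

text \<open>No edge of \<open>T - {e}\<close> crosses \<open>D\<close>, so whatever the two ends of
  \<open>e\<close> reach in \<open>T - {e}\<close> lies on opposite sides of \<open>D\<close>. Hence
  \<open>e\<close> is on no cycle of \<open>T\<close>, and its fundamental cut is contained in
  \<open>cut E D\<close>.\<close>

lemma spanning_tree_of_cuts:
  assumes G: "graph V E" and r: "r \<in> V" and TE: "T \<subseteq> E"
    and span: "\<And>v. v \<in> V \<Longrightarrow> reachable T r v"
    and cuts: "\<And>e. e \<in> T \<Longrightarrow> \<exists>D. finite (cut E D) \<and> cut E D \<inter> T = {e}"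
  shows "spanning_tree V E T \<and> finitely_separating V E T"
proof -
  have *: "\<exists>D. finite (cut E D) \<and> (\<forall>a. reachable (T - {e}) x a \<longrightarrow> a \<in> D) \<and>
      (\<forall>b. reachable (T - {e}) y b \<longrightarrow> b \<notin> D)" if e: "e \<in> T" "e = {x, y}" for e x y
  proof -
    obtain D where D: "finite (cut E D)" "cut E D \<inter> T = {e}" using cuts e by blast
    have free: "cut (T - {e}) D = {}"
      using D(2) cut_restrict[of "T - {e}" E D] TE by blast
    have "e \<in> cut E D" using D by blast
    then obtain a b where ab: "e = {a, b}" "a \<in> D" "b \<notin> D" unfolding cut_def by blast
    have free': "cut (T - {e}) (- D) = {}"
      using free unfolding cut_def by (auto simp: insert_commute)
    have fin': "finite (cut E (- D))"
    proof -
      have "cut E (- D) = cut E D" unfolding cut_def by (auto simp: insert_commute)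
      then show ?thesis using D by simp
    qed
    \<comment> \<open>If the end of \<open>e\<close> inside \<open>D\<close> is \<open>y\<close>
      instead of \<open>x\<close>, the complement of \<open>D\<close> takes over.\<close>
    have "(x = a \<and> y = b) \<or> (x = b \<and> y = a)" using ab e by (auto simp: doubleton_eq_iff)
    then show ?thesis
    proof
      assume "x = a \<and> y = b"
      then show ?thesis
        using reachable_cut_free[OF _ _ free] reachable_cut_free[OF _ _ free'] ab D(1)
        by (intro exI[of _ D]) blast
    next
      assume "x = b \<and> y = a"
      then show ?thesis
        using reachable_cut_free[OF _ _ free] reachable_cut_free[OF _ _ free'] ab fin'
        by (intro exI[of _ "- D"]) blast
    qed
  qed
  have "connected_graph V T"
    unfolding connected_graph_def using r span reachable_trans reachable_sym
    by (metis empty_iff)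
  moreover have "acyclic_edges T"
    unfolding acyclic_edges_def
  proof (intro ballI allI impI)
    fix e x y assume e: "e \<in> T" "e = {x, y}"
    obtain D where "(\<forall>a. reachable (T - {e}) x a \<longrightarrow> a \<in> D)" "(\<forall>b. reachable (T - {e}) y b \<longrightarrow> b \<notin> D)"
      using *[OF e] by blast
    then show "\<not> reachable (T - {e}) x y" using reachable_refl[of "T - {e}" y] by blast
  qed
  moreover have "finitely_separating V E T"
    unfolding finitely_separating_def
  proof (intro ballI allI impI)
    fix e x y assume e: "e \<in> T" "e = {x, y}"
    obtain D where D: "finite (cut E D)" "(\<forall>a. reachable (T - {e}) x a \<longrightarrow> a \<in> D)"
      "(\<forall>b. reachable (T - {e}) y b \<longrightarrow> b \<notin> D)"
      using *[OF e] by blast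
    have "edges_between E (comp_without V T e x) (comp_without V T e y) \<subseteq> cut E D"
      using D(2,3) unfolding edges_between_def comp_without_def cut_def by blast
    then show "finite (edges_between E (comp_without V T e x) (comp_without V T e y))"
      using D(1) finite_subset by blast
  qed
  ultimately show ?thesis unfolding spanning_tree_def using TE by blast
qed

lemma finitely_separable_of_tree:
  assumes G: "graph V E" and T: "spanning_tree V E T" and fs: "finitely_separating V E T"
  shows "finitely_separable V E"
  unfolding finitely_separable_def finitely_separable_pair_def separates_def
proof (intro ballI impI)
  fix u v assume uv: "u \<in> V" "v \<in> V" "u \<noteq> v"
  have con: "\<And>w. w \<in> V \<Longrightarrow> reachable T u w"
    using T uv unfolding spanning_tree_def connected_graph_def by blast
  \<comment> \<open>This is the first edge of the tree path from \<open>u\<close> to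
    \<open>v\<close>. The rest of the path avoids \<open>u\<close>, so it survives the deletion of
    that edge and puts \<open>v\<close> on the side of \<open>p\<close>.\<close>
  obtain p where p: "{u, p} \<in> T" "p \<noteq> u" "reachable {e \<in> T. u \<notin> e} p v"
    using reachable_last_exit[OF con[OF uv(2)] uv(3)] by blast
  let ?e = "{u, p}"
  let ?A = "comp_without V T ?e u" and ?B = "comp_without V T ?e p"
  let ?F = "edges_between E ?A ?B"
  have "\<not> reachable (T - {?e}) u p"
    using T p(1) unfolding spanning_tree_def acyclic_edges_def by blast
  moreover have "reachable (T - {?e}) p v"
    by (rule reachable_mono[OF p(3)]) auto
  ultimately have nv: "\<not> reachable (T - {?e}) u v"
    using reachable_trans reachable_sym by metis
  \<comment> \<open>Whenever a walk in \<open>T\<close> uses the edge \<open>?e\<close>, it arrives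
    at \<open>u\<close> or \<open>p\<close>, where a walk in \<open>T - {?e}\<close> can start
    afresh.\<close>
  have cover: "w \<in> ?A \<union> ?B" if "w \<in> V" for w
  proof -
    have "reachable (T - {?e}) u w \<or> reachable (T - {?e}) p w"
      using con[OF that]
    proof (induction rule: reachable_induct)
      case refl show ?case by simp
    next
      case (step b c)
      show ?case
      proof (cases "{b, c} = ?e")
        case True
        then have "c = u \<or> c = p" by (auto simp: doubleton_eq_iff)
        then show ?thesis by auto
      next
        case False
        then have "{b, c} \<in> T - {?e}" using step by blast
        then show ?thesis using step.IH reachable_step by metis
      qed
    qed
    then show ?thesis using that unfolding comp_without_def by blast
  qed
  \<comment> \<open>By \<open>cover\<close>, a walk leaving \<open>?A\<close> would enter
    \<open>?B\<close>, and the edge doing so is in \<open>?F\<close>.\<close>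
  have "w \<in> ?A" if "reachable (E - ?F) u w" for w
    using that
  proof (induction rule: reachable_induct)
    case refl show ?case using uv by (simp add: comp_without_def)
  next
    case (step b c)
    have "c \<in> V" using step graph_edgeD[OF G] by blast
    moreover have "c \<notin> ?B"
    proof
      assume "c \<in> ?B"
      then have "{b, c} \<in> ?F" using step unfolding edges_between_def by blast
      then show False using step by blast
    qed
    ultimately show ?case using cover by blast
  qed
  then have "\<not> reachable (E - ?F) u v" using nv unfolding comp_without_def by blast
  moreover have "finite ?F" using fs p(1) unfolding finitely_separating_def by blast
  moreover have "?F \<subseteq> E" unfolding edges_between_def by blast
  ultimately show "\<exists>F. finite F \<and> F \<subseteq> E \<and> \<not> reachable (E - F) u v" by blast
qed

subsection \<open>Countable graphs\<close>

text \<open>A walk can be shortened so that it uses the new edge at most once.\<close>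

lemma reachable_insert_edge:
  assumes "reachable (insert {a, b} H) t p"
  shows "reachable H t p \<or> (reachable H t a \<and> reachable H b p) \<or> (reachable H t b \<and> reachable H a p)"
  using assms
proof (induction rule: reachable_induct)
  case refl show ?case by simp
next
  case (step c d)
  consider "{c, d} \<in> H" | "c = a" "d = b" | "c = b" "d = a"
    using step(2) by (auto simp: doubleton_eq_iff)
  then show ?case
  proof cases
    case 1
    then show ?thesis using step.IH reachable_step by metis
  qed (use step.IH in auto)
qed

text \<open>A finite tree \<open>T\<close> rooted at \<open>r\<close> together with a finite set \<open>F\<close> of edges whose deletion
  leaves exactly one component for each vertex of \<open>T\<close>. Later trees will meet \<open>F\<close> in \<open>T\<close> only,
  so that \<open>F\<close> contains the fundamental cuts of the edges of \<open>T\<close> once and for all.\<close>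

definition tree_stage :: "'a set \<Rightarrow> 'a set set \<Rightarrow> 'a \<Rightarrow> 'a set set \<Rightarrow> 'a set set \<Rightarrow> bool" where
  "tree_stage V E r T F \<longleftrightarrow> finite F \<and> T \<subseteq> F \<and> T \<subseteq> E
     \<and> (\<forall>x\<in>insert r (\<Union>T). reachable T r x)
     \<and> (\<forall>v\<in>V. \<exists>x\<in>insert r (\<Union>T). reachable (E - F) x v)
     \<and> (\<forall>x\<in>insert r (\<Union>T). \<forall>y\<in>insert r (\<Union>T). x \<noteq> y \<longrightarrow> \<not> reachable (E - F) x y)
     \<and> (\<forall>x y. {x, y} \<in> T \<longrightarrow> \<not> reachable ((E - F) \<union> (T - {{x, y}})) x y)"

text \<open>A minimal \<open>K\<close> separating \<open>t\<close> from \<open>p\<close> in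
  \<open>E - F\<close> splits the component of \<open>t\<close> into exactly two, one around each of
  \<open>t\<close> and \<open>p\<close>, so there is again one component per tree vertex. Keeping
  \<open>K\<close> inside the given \<open>K0\<close> lets the caller control which edges become
  frozen.\<close>

lemma tree_stage_add_edge:
  assumes S: "tree_stage V E r T F" and t: "t \<in> insert r (\<Union>T)"
    and f: "{t, p} \<in> E - F" and tp: "t \<noteq> p"
    and K0: "finite K0" "\<not> reachable (E - F - K0) t p"
  shows "\<exists>K\<subseteq>K0. tree_stage V E r (insert {t, p} T) (F \<union> K)"
proof -
  let ?X = "insert r (\<Union>T)"
  let ?T = "insert {t, p} T"
  have X': "insert r (\<Union>?T) = insert p ?X" using t by auto
  have S1: "finite F" "T \<subseteq> F" "T \<subseteq> E"
    and S2: "\<And>x. x \<in> ?X \<Longrightarrow> reachable T r x"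
    and S3: "\<And>v. v \<in> V \<Longrightarrow> \<exists>x\<in>?X. reachable (E - F) x v"
    and S4: "\<And>x y. x \<in> ?X \<Longrightarrow> y \<in> ?X \<Longrightarrow> x \<noteq> y \<Longrightarrow> \<not> reachable (E - F) x y"
    and S5: "\<And>x y. {x, y} \<in> T \<Longrightarrow> \<not> reachable ((E - F) \<union> (T - {{x, y}})) x y"
    using S unfolding tree_stage_def by blast+
  have pX: "p \<notin> ?X" using S4[OF t _ tp] reachable_edge[OF f] by blast
  let ?A = "{K. K \<subseteq> K0 \<and> \<not> reachable (E - F - K) t p}"
  have "finite ?A" using K0(1) by simp
  moreover have "?A \<noteq> {}" using K0(2) by blast
  ultimately obtain K where KA: "K \<in> ?A" and Kmin: "\<forall>K'\<in>?A. K' \<subseteq> K \<longrightarrow> K = K'"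
    by (rule finite_has_minimal[THEN bexE])
  then have K: "K \<subseteq> K0" by simp
  let ?H = "E - F - K"
  have H: "E - (F \<union> K) = ?H" by blast
  have sep: "\<not> reachable ?H t p" using KA by simp
  have fK: "{t, p} \<in> K" using sep f reachable_edge[of t p ?H] by blast
  \<comment> \<open>By minimality, putting an edge of \<open>K\<close> back reconnects
    \<open>t\<close> and \<open>p\<close>, so its ends lie in the components of \<open>t\<close> and
    \<open>p\<close>.\<close>
  have ends: "reachable ?H t c \<or> reachable ?H p c" if "{b, c} \<in> K" "{b, c} \<in> E - F" for b c
  proof -
    have "K - {{b, c}} \<notin> ?A" using Kmin that(1) by blast
    moreover have "K - {{b, c}} \<subseteq> K0" using K by blast
    ultimately have "reachable (E - F - (K - {{b, c}})) t p" by simp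
    then have "reachable (insert {b, c} ?H) t p" by (rule reachable_mono) blast
    then show ?thesis using reachable_insert_edge sep reachable_sym by metis
  qed
  have B1: "\<not> reachable ?H p y" if "y \<in> ?X" for y
  proof
    assume py: "reachable ?H p y"
    show False
    proof (cases "y = t")
      case True then show False using py sep reachable_sym by metis
    next
      case False
      have "reachable (E - F) p y" by (rule reachable_mono[OF py]) blast
      then have "reachable (E - F) t y" using reachable_edge[OF f] reachable_trans by metis
      then show False using S4[OF t that] False by blast
    qed
  qed
  have B: "\<forall>x\<in>insert p ?X. \<forall>y\<in>insert p ?X. x \<noteq> y \<longrightarrow> \<not> reachable ?H x y"
  proof (intro ballI impI notI)
    fix x y assume xy: "x \<in> insert p ?X" "y \<in> insert p ?X" "x \<noteq> y" "reachable ?H x y"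
    have "reachable (E - F) x y" by (rule reachable_mono[OF xy(4)]) blast
    then have "x = p \<or> y = p" using S4 xy by blast
    then show False using B1 xy reachable_sym by (metis insertE)
  qed
  have A: "\<forall>v\<in>V. \<exists>x\<in>insert p ?X. reachable ?H x v"
  proof
    fix v assume "v \<in> V"
    then obtain x where x: "x \<in> ?X" "reachable (E - F) x v" using S3 by blast
    from x(2) show "\<exists>x\<in>insert p ?X. reachable ?H x v"
    proof (induction rule: reachable_induct)
      case refl show ?case using x(1) by (intro bexI[of _ x]) simp_all
    next
      case (step b c)
      then obtain x' where x': "x' \<in> insert p ?X" "reachable ?H x' b" by blast
      show ?case
      proof (cases "{b, c} \<in> K")
        case True
        then have "reachable ?H t c \<or> reachable ?H p c" using ends step(2) by blast
        then show ?thesis using t by blast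
      next
        case False
        then have "{b, c} \<in> ?H" using step(2) by blast
        then show ?thesis using x' reachable_step by metis
      qed
    qed
  qed
  have C: "\<forall>x\<in>insert p ?X. reachable ?T r x"
  proof -
    have old: "reachable ?T r x" if "x \<in> ?X" for x
      by (rule reachable_mono[OF S2[OF that]]) blast
    have "reachable ?T r p" by (rule reachable_step[OF old[OF t]]) blast
    then show ?thesis using old by blast
  qed
  \<comment> \<open>By \<open>B1\<close> the component of \<open>p\<close> in \<open>?H\<close>
    contains no vertex of the old tree, so no edge of \<open>T\<close> leaves it.\<close>
  have new: "\<not> reachable (?H \<union> T) p t"
  proof
    assume r: "reachable (?H \<union> T) p t"
    define D where "D = {q. reachable ?H p q}"
    have "cut (?H \<union> T) D = {}"
    proof (rule ccontr)
      assume "cut (?H \<union> T) D \<noteq> {}"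
      then obtain a b where ab: "{a, b} \<in> ?H \<union> T" "a \<in> D" "b \<notin> D" unfolding cut_def by blast
      then have "{a, b} \<notin> ?H" using reachable_step unfolding D_def by (metis mem_Collect_eq)
      then have "a \<in> ?X" using ab by blast
      then show False using B1 ab unfolding D_def by blast
    qed
    moreover have "p \<in> D" unfolding D_def by simp
    ultimately have "t \<in> D" using reachable_cut_free[OF r] by blast
    then show False using B1[OF t] unfolding D_def by blast
  qed
  have D: "\<forall>x y. {x, y} \<in> ?T \<longrightarrow> \<not> reachable (?H \<union> (?T - {{x, y}})) x y"
  proof (intro allI impI notI)
    fix x y assume xy: "{x, y} \<in> ?T" and re: "reachable (?H \<union> (?T - {{x, y}})) x y"
    show False
    proof (cases "{x, y} = {t, p}")
      case True
      have "reachable (?H \<union> T) x y" by (rule reachable_mono[OF re]) (use True in auto)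
      moreover have "(x = t \<and> y = p) \<or> (x = p \<and> y = t)"
        using True by (auto simp: doubleton_eq_iff)
      ultimately show False using new reachable_sym by metis
    next
      case False
      \<comment> \<open>The new edge belongs to \<open>E - F\<close>, so for an old tree edge the
        old invariant already covers it.\<close>
      have "reachable ((E - F) \<union> (T - {{x, y}})) x y"
        by (rule reachable_mono[OF re]) (use f in auto)
      then show False using S5 xy False by blast
    qed
  qed
  have "finite (F \<union> K)" using S1(1) finite_subset[OF K K0(1)] by simp
  moreover have "?T \<subseteq> F \<union> K" "?T \<subseteq> E" using S1 fK f by blast+
  ultimately have "tree_stage V E r ?T (F \<union> K)"
    unfolding tree_stage_def X' H using A B C D by blast
  then show ?thesis using K by blast
qed

text \<open>A path from the tree to \<open>v\<close> is added edge by edge. The edges frozen on the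
  way must spare the rest of the path, so they are chosen from a finite cut around \<open>t\<close>
  that has all other vertices of the path on its far side.\<close>

lemma tree_stage_extend:
  assumes G: "graph V E" and fs: "finitely_separable V E"
    and S: "tree_stage V E r T F" and v: "v \<in> V"
  shows "\<exists>T' F'. tree_stage V E r T' F' \<and> T \<subseteq> T' \<and> F \<subseteq> F' \<and> T' \<inter> F \<subseteq> T \<and> v \<in> insert r (\<Union>T')"
proof -
  obtain t where t: "t \<in> insert r (\<Union>T)" "reachable (E - F) t v"
    using S v unfolding tree_stage_def by blast
  obtain W where W: "finite W" "reachable {e \<in> E - F. e \<subseteq> W} t v"
    using reachable_finite_support[OF t(2)] by blast
  from W S t(1) show ?thesis
  proof (induction "card W" arbitrary: W t T F rule: less_induct)
    case less
    show ?case
    proof (cases "t = v")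
      case True
      then show ?thesis using less.prems by blast
    next
      case False
      let ?W = "W - {t}"
      obtain p where p: "{t, p} \<in> {e \<in> E - F. e \<subseteq> W}" "p \<noteq> t"
        "reachable {e \<in> {e \<in> E - F. e \<subseteq> W}. t \<notin> e} p v"
        using reachable_last_exit[OF less.prems(2) False] by blast
      have tV: "t \<in> V" using p(1) graph_edgeD[OF G] by blast
      \<comment> \<open>\<open>W\<close> may contain elements that are not vertices; separators from
        \<open>t\<close> exist only for those in \<open>V\<close>.\<close>
      have "\<exists>K. finite K \<and> \<not> reachable (E - K) t q" if "q \<in> ?W \<inter> V" for q
        using separating_set_exists[OF fs tV, of q] that by blast
      then obtain k where k: "\<And>q. q \<in> ?W \<inter> V \<Longrightarrow> finite (k q) \<and> \<not> reachable (E - k q) t q"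
        by metis
      define K where "K = \<Union>(k ` (?W \<inter> V))"
      have finK: "finite K" unfolding K_def using less.prems(1) k by blast
      define D where "D = {q. reachable (E - F - K) t q}"
      have DW: "q \<notin> D" if q: "q \<in> ?W" for q
      proof
        assume qD: "q \<in> D"
        then have "reachable (E - F - K) t q" unfolding D_def by blast
        moreover have "q \<in> V"
          using reachable_in_graph[OF calculation graph_subset[OF G] tV] by blast
        moreover have "reachable (E - k q) t q"
          by (rule reachable_mono[OF calculation(1)]) (use q calculation(2) in \<open>auto simp: K_def\<close>)
        ultimately show False using k q by blast
      qed
      have cutK: "cut (E - F) D \<subseteq> K"
        using cut_reachable_set[of "E - F - K" "E - F" D t] unfolding D_def by blast
      have pW: "p \<in> ?W" using p by auto
      have "cut (E - F - cut (E - F) D) D = {}" unfolding cut_def by blast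
      moreover have "t \<in> D" unfolding D_def by simp
      ultimately have "\<not> reachable (E - F - cut (E - F) D) t p"
        using reachable_cut_free DW[OF pW] by metis
      moreover have "finite (cut (E - F) D)" using cutK finK finite_subset by blast
      moreover have "{t, p} \<in> E - F" using p by blast
      ultimately obtain L where L: "L \<subseteq> cut (E - F) D" "tree_stage V E r (insert {t, p} T) (F \<union> L)"
        using tree_stage_add_edge[OF less.prems(3,4)] p(2) by metis
      \<comment> \<open>Every edge of \<open>L\<close> has an end in \<open>D\<close>, which misses
        \<open>?W\<close>; so the rest of the path, lying within \<open>?W\<close>, keeps all its
        edges.\<close>
      have Wcut: "e \<notin> L" if "e \<subseteq> ?W" for e
        using that L(1) DW unfolding cut_def by blast
      have re: "reachable {e \<in> E - (F \<union> L). e \<subseteq> ?W} p v"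
      proof (rule reachable_mono[OF p(3)])
        show "{e \<in> {e \<in> E - F. e \<subseteq> W}. t \<notin> e} \<subseteq> {e \<in> E - (F \<union> L). e \<subseteq> ?W}"
        proof
          fix e assume "e \<in> {e \<in> {e \<in> E - F. e \<subseteq> W}. t \<notin> e}"
          then have "e \<subseteq> ?W" "e \<in> E - F" by auto
          then show "e \<in> {e \<in> E - (F \<union> L). e \<subseteq> ?W}" using Wcut by blast
        qed
      qed
      have tW: "t \<in> W" using p by blast
      have "card ?W < card W" using tW less.prems(1) by (meson card_Diff1_less)
      moreover have "finite ?W" using less.prems(1) by simp
      moreover have "p \<in> insert r (\<Union>(insert {t, p} T))" by blast
      ultimately obtain T' F' where T': "tree_stage V E r T' F'" "insert {t, p} T \<subseteq> T'" "F \<union> L \<subseteq> F'"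
        "T' \<inter> (F \<union> L) \<subseteq> insert {t, p} T" "v \<in> insert r (\<Union>T')"
        using less.hyps[OF _ _ re L(2)] by metis
      \<comment> \<open>The one edge added here, \<open>{t, p}\<close>, is outside
        \<open>F\<close>.\<close>
      moreover have "T' \<inter> F \<subseteq> T" using T'(4) p(1) by blast
      ultimately show ?thesis by blast
    qed
  qed
qed

text \<open>The union of a sequence of stages, the step from \<open>n\<close> to
  \<open>Suc n\<close> absorbing the \<open>n\<close>-th vertex. The finite cut of an edge is found
  at a stage containing it, and later stages add no tree edge to that cut because its edges are
  frozen.\<close>

lemma countable_tree_with_cuts:
  assumes G: "graph V E" and con: "connected_graph V E" and fs: "finitely_separable V E"
    and count: "countable V" and r: "r \<in> V"
  shows "\<exists>T\<subseteq>E. (\<forall>v\<in>V. reachable T r v) \<and> (\<forall>e\<in>T. \<exists>D. finite (cut E D) \<and> cut E D \<inter> T = {e})"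
proof -
  let ?P = "\<lambda>n S. tree_stage V E r (fst S) (snd S)"
  let ?Q = "\<lambda>n S S'. fst S \<subseteq> fst S' \<and> snd S \<subseteq> snd S' \<and> fst S' \<inter> snd S \<subseteq> fst S
    \<and> from_nat_into V n \<in> insert r (\<Union>(fst S'))"
  have "\<exists>f. \<forall>n. ?P n (f n) \<and> ?Q n (f n) (f (Suc n))"
  proof (rule dependent_nat_choice)
    have "tree_stage V E r {} {}"
      using con r unfolding tree_stage_def connected_graph_def by auto
    then show "\<exists>S. ?P 0 S" by (intro exI[of _ "({}, {})"]) simp
  next
    fix S n assume "?P n S"
    \<comment> \<open>As \<open>r\<close> shows \<open>V\<close> to be nonempty,
      \<open>from_nat_into V n\<close> is in \<open>V\<close> for every \<open>n\<close>, even if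
      \<open>V\<close> is finite and the values repeat.\<close>
    then obtain T' F' where "tree_stage V E r T' F'" "fst S \<subseteq> T'" "snd S \<subseteq> F'"
      "T' \<inter> snd S \<subseteq> fst S" "from_nat_into V n \<in> insert r (\<Union>T')"
      using tree_stage_extend[OF G fs, of r "fst S" "snd S" "from_nat_into V n"]
        from_nat_into[of V n] r by blast
    then show "\<exists>S'. ?P (Suc n) S' \<and> ?Q n S S'" by (intro exI[of _ "(T', F')"]) simp
  qed
  then obtain f where f: "\<forall>n. ?P n (f n) \<and> ?Q n (f n) (f (Suc n))" ..
  define T F where "T n = fst (f n)" and "F n = snd (f n)" for n
  have st: "tree_stage V E r (T n) (F n)" for n using f unfolding T_def F_def by simp
  have step: "T n \<subseteq> T (Suc n)" "F n \<subseteq> F (Suc n)" "T (Suc n) \<inter> F n \<subseteq> T n"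
    "from_nat_into V n \<in> insert r (\<Union>(T (Suc n)))" for n
    using f[rule_format, of n] unfolding T_def F_def by auto
  have Tmono: "m \<le> n \<Longrightarrow> T m \<subseteq> T n" for m n using step(1) lift_Suc_mono_le[of T] by blast
  have frozen: "T (m + k) \<inter> F m \<subseteq> T m" for m k
  proof (induction k)
    case 0 show ?case by simp
  next
    case (Suc k)
    have "F m \<subseteq> F (m + k)" using step(2) lift_Suc_mono_le[of F m "m + k"] by simp
    then show ?case using Suc step(3)[of "m + k"] by auto
  qed
  let ?T = "\<Union>(range T)"
  have froz: "?T \<inter> F n \<subseteq> T n" for n
  proof
    fix e assume e: "e \<in> ?T \<inter> F n"
    then obtain m where "e \<in> T m" by blast
    then have "e \<in> T (n + m)" using Tmono[of m "n + m"] by auto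
    then show "e \<in> T n" using frozen e by blast
  qed
  have "?T \<subseteq> E" using st unfolding tree_stage_def by blast
  moreover have "\<forall>v\<in>V. reachable ?T r v"
  proof
    fix v assume "v \<in> V"
    then obtain n where "from_nat_into V n = v" using from_nat_into_surj[OF count] by blast
    then have "v \<in> insert r (\<Union>(T (Suc n)))" using step(4)[of n] by simp
    then have "reachable (T (Suc n)) r v" using st[of "Suc n"] unfolding tree_stage_def by blast
    then show "reachable ?T r v" by (rule reachable_mono) blast
  qed
  moreover have "\<forall>e\<in>?T. \<exists>D. finite (cut E D) \<and> cut E D \<inter> ?T = {e}"
  proof
    fix e assume "e \<in> ?T"
    then obtain n where n: "e \<in> T n" by blast
    have TE: "T n \<subseteq> E" and finF: "finite (F n)" using st[of n] unfolding tree_stage_def by blast+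
    obtain x y where xy: "e = {x, y}" using graph_edgeE[OF G] n TE by blast
    let ?H = "(E - F n) \<union> (T n - {{x, y}})"
    have nre: "\<not> reachable ?H x y" using st[of n] n xy unfolding tree_stage_def by blast
    \<comment> \<open>The edges of \<open>E\<close> missing from \<open>?H\<close> all lie in
      \<open>F n\<close>, and \<open>e\<close> is the only one of them in \<open>T n\<close>. So the
      cut of \<open>D\<close> is finite, and by \<open>froz\<close> it meets the final tree in
      \<open>e\<close> only.\<close>
    define D where "D = {p. reachable ?H x p}"
    have sub: "cut E D \<subseteq> E - ?H" by (rule cut_reachable_set[OF _ D_def]) (use TE in blast)
    have "e \<in> cut E D"
      unfolding xy by (rule cutI) (use n TE xy nre in \<open>auto simp: D_def\<close>)
    moreover have "cut E D \<subseteq> F n" using sub by blast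
    moreover have "cut E D \<inter> T n \<subseteq> {e}" using sub xy by blast
    ultimately have "finite (cut E D) \<and> cut E D \<inter> ?T = {e}"
      using froz[of n] n finF finite_subset by blast
    then show "\<exists>D. finite (cut E D) \<and> cut E D \<inter> ?T = {e}" by blast
  qed
  ultimately show ?thesis by blast
qed

subsection \<open>Countability of blocks\<close>

text \<open>Every component of \<open>G - X\<close> has at most one neighbour in \<open>X\<close>.\<close>

definition hinged :: "'a set set \<Rightarrow> 'a set \<Rightarrow> bool" where
  "hinged E X \<longleftrightarrow> (\<forall>x\<in>X. \<forall>z. z \<notin> X \<longrightarrow> {x, z} \<in> E \<longrightarrow>
     (\<forall>x'\<in>X. x' \<noteq> x \<longrightarrow> \<not> reachable {e \<in> E. x \<notin> e} z x'))"

lemma hingedD: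
  "hinged E X \<Longrightarrow> x \<in> X \<Longrightarrow> z \<notin> X \<Longrightarrow> {x, z} \<in> E \<Longrightarrow> x' \<in> X \<Longrightarrow> x' \<noteq> x \<Longrightarrow>
     \<not> reachable {e \<in> E. x \<notin> e} z x'"
  unfolding hinged_def by blast

text \<open>A walk that leaves \<open>X\<close> at \<open>u\<close> can return to \<open>X\<close>
  only at \<open>u\<close>, so its excursions can be cut out. Allowing any subgraph \<open>H\<close>
  makes this usable after a cut has been deleted.\<close>

lemma hinged_reachable:
  assumes hin: "hinged E X" and HE: "H \<subseteq> E" and re: "reachable H a p" and a: "a \<in> X" and p: "p \<in> X"
  shows "reachable (H \<inter> Pow X) a p"
proof -
  let ?R = "reachable (H \<inter> Pow X) a"
  \<comment> \<open>While the walk is outside \<open>X\<close>, the invariant remembers the exit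
    \<open>u\<close> and its outside neighbour \<open>n\<close>, from which the walk has avoided
    \<open>u\<close>.\<close>
  from re have "(p \<in> X \<and> ?R p) \<or>
    (p \<notin> X \<and> (\<exists>u\<in>X. ?R u \<and> (\<exists>n. n \<notin> X \<and> {u, n} \<in> E \<and> reachable {e \<in> E. u \<notin> e} n p)))"
  proof (induction rule: reachable_induct)
    case refl show ?case using a by simp
  next
    case (step b c)
    show ?case
    proof (cases "b \<in> X")
      case True
      then have b: "?R b" using step.IH by blast
      show ?thesis
      proof (cases "c \<in> X")
        case cX: True
        have "{b, c} \<in> H \<inter> Pow X" using True cX step(2) by blast
        then show ?thesis using b cX reachable_step by metis
      next
        case False
        have "{b, c} \<in> E" using step(2) HE by blast
        then show ?thesis using False b True reachable_refl by metis
      qed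
    next
      case False
      then obtain u n where u: "u \<in> X" "?R u" "n \<notin> X" "{u, n} \<in> E"
        "reachable {e \<in> E. u \<notin> e} n b"
        using step.IH by blast
      show ?thesis
      proof (cases "c = u")
        case True then show ?thesis using u by blast
      next
        case cu: False
        have "{b, c} \<in> {e \<in> E. u \<notin> e}" using step(2) HE cu False u(1) by auto
        then have "reachable {e \<in> E. u \<notin> e} n c" using u(5) reachable_step by metis
        moreover from this have "c \<notin> X" using hingedD[OF hin u(1,3,4)] cu by blast
        ultimately show ?thesis using u by blast
      qed
    qed
  qed
  then show ?thesis using p by blast
qed

text \<open>Let \<open>D\<close> be all that is reachable from \<open>A \<inter> Y\<close> once the
  cut inside \<open>Y\<close> is deleted. Detours outside \<open>Y\<close> return to where they
  left, so \<open>D\<close> meets \<open>Y\<close> in \<open>A \<inter> Y\<close> only and no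
  further edge crosses.\<close>

lemma hinged_lift_cut:
  assumes hin: "hinged E Y"
  shows "\<exists>D. cut E D = cut (E \<inter> Pow Y) A"
proof -
  let ?F = "cut (E \<inter> Pow Y) A"
  define D where "D = {p. \<exists>a\<in>A \<inter> Y. reachable (E - ?F) a p}"
  have "cut E D \<subseteq> ?F"
  proof
    fix e assume "e \<in> cut E D"
    then obtain c d where cd: "e = {c, d}" "{c, d} \<in> E" "c \<in> D" "d \<notin> D" unfolding cut_def by blast
    show "e \<in> ?F"
    proof (rule ccontr)
      assume "e \<notin> ?F"
      then have "{c, d} \<in> E - ?F" using cd by blast
      then have "d \<in> D" using cd(3) reachable_step unfolding D_def mem_Collect_eq by metis
      then show False using cd by blast
    qed
  qed
  moreover have "?F \<subseteq> cut E D"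
  proof
    fix e assume "e \<in> ?F"
    then obtain a b where ab: "e = {a, b}" "{a, b} \<in> E" "a \<in> A \<inter> Y" "b \<in> Y" "b \<notin> A"
      unfolding cut_def by blast
    have "a \<in> D" using ab(3) reachable_refl unfolding D_def mem_Collect_eq by metis
    moreover have "b \<notin> D"
    proof
      assume "b \<in> D"
      then obtain a' where a': "a' \<in> A \<inter> Y" "reachable (E - ?F) a' b" unfolding D_def by blast
      then have "reachable ((E - ?F) \<inter> Pow Y) a' b"
        using hinged_reachable[OF hin _ a'(2)] ab(4) by blast
      moreover have "cut ((E - ?F) \<inter> Pow Y) A = {}" unfolding cut_def by blast
      ultimately have "b \<in> A" using reachable_cut_free a'(1) by (metis IntD1)
      then show False using ab by blast
    qed
    ultimately show "e \<in> cut E D" unfolding ab(1) using ab(2) by (intro cutI)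
  qed
  ultimately show ?thesis by blast
qed

lemma countable_rtrancl_Image:
  assumes "\<And>x. countable (R `` {x})"
  shows "countable (R\<^sup>* `` {x})"
proof -
  have "countable ((R ^^ n) `` {x})" for n
  proof (induction n)
    case 0 show ?case by simp
  next
    case (Suc n)
    have "(R ^^ Suc n) `` {x} = (\<Union>s\<in>(R ^^ n) `` {x}. R `` {s})" by auto
    then show ?case using Suc assms by auto
  qed
  moreover have "R\<^sup>* `` {x} = (\<Union>n. (R ^^ n) `` {x})" by (auto simp: rtrancl_is_UN_relpow)
  ultimately show ?thesis by auto
qed

lemma countable_nbrs_in_component:
  assumes G: "graph V E" and fs: "finitely_separable V E" and u: "u \<in> V"
    and nb: "\<And>n. n \<in> N \<Longrightarrow> {u, n} \<in> E"
    and comp: "\<And>n n'. n \<in> N \<Longrightarrow> n' \<in> N \<Longrightarrow> reachable {e \<in> E. u \<notin> e} n n'"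
  shows "countable N"
proof (cases "N = {}")
  case False
  then obtain n0 where n0: "n0 \<in> N" by blast
  have "\<exists>F. finite F \<and> \<not> reachable (E - F) a u" if "a \<in> V - {u}" for a
    using separating_set_exists[OF fs _ u, of a] that by blast
  then obtain F where F: "\<And>a. a \<in> V - {u} \<Longrightarrow> finite (F a) \<and> \<not> reachable (E - F a) a u"
    by metis
  \<comment> \<open>From \<open>a\<close>, \<open>R\<close> leads to the ends, other than
    \<open>u\<close>, of the edges in the separator of \<open>a\<close>. These are finitely many, so
    the closure \<open>?W\<close> of \<open>n0\<close> under \<open>R\<close> is countable.\<close>
  define R where "R = {(a, b). a \<in> V - {u} \<and> b \<in> \<Union>(F a \<inter> E) \<and> b \<noteq> u}"
  let ?W = "R\<^sup>* `` {n0}"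
  have fin: "finite (\<Union>(F a \<inter> E))" if "a \<in> V - {u}" for a
  proof (rule finite_Union)
    show "finite (F a \<inter> E)" using F[OF that] by simp
    show "finite e" if "e \<in> F a \<inter> E" for e
      using graph_edgeE[OF G, of e] that by (metis IntD2 finite.emptyI finite_insert)
  qed
  have "countable (R `` {a})" for a
  proof (cases "a \<in> V - {u}")
    case True
    have "R `` {a} \<subseteq> \<Union>(F a \<inter> E)" unfolding R_def by blast
    then show ?thesis using fin[OF True] countable_finite finite_subset by metis
  next
    case False
    then have "R `` {a} = {}" unfolding R_def by blast
    then show ?thesis by simp
  qed
  then have W: "countable ?W" by (rule countable_rtrancl_Image)
  have n0V: "n0 \<in> V - {u}" using graph_edgeD[OF G nb[OF n0]] by blast
  have WV: "a \<in> V - {u}" if "(n0, a) \<in> R\<^sup>*" for a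
    using that
  proof (induction rule: rtrancl_induct)
    case base show ?case by (rule n0V)
  next
    case (step b c)
    then obtain e where e: "e \<in> E" "c \<in> e" "c \<noteq> u" unfolding R_def by blast
    then show ?case using graph_edgeE[OF G e(1)] by blast
  qed
  \<comment> \<open>Follow a walk from \<open>n0\<close>: when it crosses an edge of the current
    \<open>F a\<close>, the end reached is itself in the closure and replaces
    \<open>a\<close>.\<close>
  have cover: "\<exists>a. (n0, a) \<in> R\<^sup>* \<and> reachable (E - F a) a p" if "reachable {e \<in> E. u \<notin> e} n0 p" for p
    using that
  proof (induction rule: reachable_induct)
    case refl show ?case by (intro exI[of _ n0]) simp
  next
    case (step b c)
    then obtain a where a: "(n0, a) \<in> R\<^sup>*" "reachable (E - F a) a b" by blast
    show ?case
    proof (cases "{b, c} \<in> F a")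
      case True
      then have "(a, c) \<in> R" using step(2) WV[OF a(1)] unfolding R_def by blast
      then have "(n0, c) \<in> R\<^sup>*" using a(1) by simp
      then show ?thesis using reachable_refl by metis
    next
      case False
      then have "{b, c} \<in> E - F a" using step(2) by blast
      then show ?thesis using a reachable_step by metis
    qed
  qed
  have "N \<subseteq> (\<Union>a\<in>?W. \<Union>(F a \<inter> E))"
  proof
    fix n assume n: "n \<in> N"
    obtain a where a: "(n0, a) \<in> R\<^sup>*" "reachable (E - F a) a n" using cover[OF comp[OF n0 n]] by blast
    have "{n, u} \<in> E" using nb[OF n] by (simp add: insert_commute)
    \<comment> \<open>Otherwise \<open>a\<close> would reach \<open>u\<close> through
      \<open>n\<close> without using \<open>F a\<close>.\<close>
    moreover have "{n, u} \<in> F a"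
    proof (rule ccontr)
      assume "{n, u} \<notin> F a"
      then have "{n, u} \<in> E - F a" using calculation by blast
      then have "reachable (E - F a) a u" using a(2) reachable_step by metis
      then show False using F WV[OF a(1)] by blast
    qed
    ultimately show "n \<in> (\<Union>a\<in>?W. \<Union>(F a \<inter> E))" using a(1) by blast
  qed
  moreover have "countable (\<Union>a\<in>?W. \<Union>(F a \<inter> E))"
  proof (rule countable_UN[OF W])
    fix a assume "a \<in> ?W"
    then show "countable (\<Union>(F a \<inter> E))" using fin WV countable_finite by blast
  qed
  ultimately show ?thesis using countable_subset by blast
qed simp

text \<open>The block of the edge \<open>xv\<close>: the vertices that no other single vertex separates from it.\<close>

definition block :: "'a set set \<Rightarrow> 'a \<Rightarrow> 'a \<Rightarrow> 'a set" where
  "block E x v = {z. \<forall>w. w \<noteq> z \<longrightarrow> (\<exists>a\<in>{x, v}. a \<noteq> w \<and> reachable {e \<in> E. w \<notin> e} a z)}"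

lemma blockD:
  assumes "z \<in> block E x v" "w \<noteq> z"
  obtains a where "a \<in> {x, v}" "a \<noteq> w" "reachable {e \<in> E. w \<notin> e} a z"
  using assms unfolding block_def by blast

lemma block_ends: "x \<in> block E x v" "v \<in> block E x v"
proof -
  show "x \<in> block E x v"
    unfolding block_def mem_Collect_eq by (intro allI impI bexI[of _ x]) auto
  show "v \<in> block E x v"
    unfolding block_def mem_Collect_eq by (intro allI impI bexI[of _ v]) auto
qed

text \<open>Avoiding \<open>w\<close>, each of \<open>z\<close> and \<open>z'\<close> is linked to
  an end of \<open>xv\<close> other than \<open>w\<close>; if these ends differ, the edge
  \<open>xv\<close> itself avoids \<open>w\<close> and joins them.\<close>

lemma block_no_cutvertex:
  assumes e: "{x, v} \<in> E" and z: "z \<in> block E x v" "z' \<in> block E x v" and w: "w \<noteq> z" "w \<noteq> z'"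
  shows "reachable {e \<in> E. w \<notin> e} z z'"
proof -
  obtain a where a: "a \<in> {x, v}" "a \<noteq> w" "reachable {e \<in> E. w \<notin> e} a z" using blockD[OF z(1) w(1)] .
  obtain b where b: "b \<in> {x, v}" "b \<noteq> w" "reachable {e \<in> E. w \<notin> e} b z'" using blockD[OF z(2) w(2)] .
  have ab: "reachable {e \<in> E. w \<notin> e} a b"
  proof (cases "a = b")
    case False
    then have "{a, b} = {x, v}" using a b by auto
    then have "{a, b} \<in> {e \<in> E. w \<notin> e}" using e a b by auto
    then show ?thesis by (rule reachable_edge)
  qed simp
  show ?thesis by (rule reachable_trans[OF reachable_trans[OF reachable_sym[OF a(3)] ab] b(3)])
qed

text \<open>Some \<open>w\<close> separates an outside vertex \<open>z\<close> from the ends of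
  \<open>xv\<close>. A block neighbour \<open>u\<close> of \<open>z\<close> must be that
  \<open>w\<close>, as it would otherwise pass a connection on to \<open>z\<close>; a return from
  \<open>z\<close> to another block vertex avoiding \<open>u\<close> would again connect
  \<open>z\<close> to an end.\<close>

lemma block_hinged:
  assumes "{x, v} \<in> E"
  shows "hinged E (block E x v)"
  unfolding hinged_def
proof (intro ballI allI impI notI)
  fix u z u'
  assume u: "u \<in> block E x v" and z: "z \<notin> block E x v" and uz: "{u, z} \<in> E"
    and u': "u' \<in> block E x v" "u' \<noteq> u" and re: "reachable {e \<in> E. u \<notin> e} z u'"
  obtain w where w: "w \<noteq> z" "\<And>a. a \<in> {x, v} \<Longrightarrow> a \<noteq> w \<Longrightarrow> \<not> reachable {e \<in> E. w \<notin> e} a z"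
    using z unfolding block_def by blast
  show False
  proof (cases "u = w")
    case True
    have "w \<noteq> u'" using u'(2) True by simp
    then obtain a where a: "a \<in> {x, v}" "a \<noteq> w" "reachable {e \<in> E. w \<notin> e} a u'"
      by (rule blockD[OF u'(1)])
    have "reachable {e \<in> E. w \<notin> e} u' z" using reachable_sym[OF re] True by simp
    then show False using w(2)[OF a(1,2)] reachable_trans[OF a(3)] by blast
  next
    case False
    obtain a where a: "a \<in> {x, v}" "a \<noteq> w" "reachable {e \<in> E. w \<notin> e} a u"
      by (rule blockD[OF u False[symmetric]])
    have "{u, z} \<in> {e \<in> E. w \<notin> e}" using uz False w(1) by auto
    then show False using w(2)[OF a(1,2)] reachable_step[OF a(3)] by blast
  qed
qed

lemma block_subset:
  assumes G: "graph V E" and e: "{x, v} \<in> E"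
  shows "block E x v \<subseteq> V"
proof
  fix z assume z: "z \<in> block E x v"
  have xv: "x \<in> V" "v \<in> V" "x \<noteq> v" using graph_edgeD[OF G e] by auto
  \<comment> \<open>The definition of \<open>block\<close> constrains \<open>z\<close> only through
    some \<open>w\<close> other than \<open>z\<close>; one of \<open>x\<close> and \<open>v\<close>
    is such.\<close>
  then obtain w where "w \<noteq> z" by metis
  then obtain a where "a \<in> {x, v}" "reachable {e \<in> E. w \<notin> e} a z" using blockD[OF z] by metis
  moreover have "graph V {e \<in> E. w \<notin> e}" by (rule graph_subset[OF G]) blast
  ultimately show "z \<in> V" using reachable_in_graph xv by (metis insertE singletonD)
qed

lemma block_connected:
  assumes G: "graph V E" and con: "connected_graph V E" and e: "{x, v} \<in> E"
  shows "connected_graph (block E x v) (E \<inter> Pow (block E x v))"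
  unfolding connected_graph_def
proof (intro conjI ballI)
  show "block E x v \<noteq> {}" using block_ends by (metis empty_iff)
next
  fix y z assume yz: "y \<in> block E x v" "z \<in> block E x v"
  then have "reachable E y z"
    using con block_subset[OF G e] unfolding connected_graph_def by blast
  then show "reachable (E \<inter> Pow (block E x v)) y z"
    using hinged_reachable[OF block_hinged[OF e] _ _ yz] by blast
qed

text \<open>The neighbours of \<open>u\<close> inside the block lie in one component of
  \<open>G - u\<close>, hence are countably many. A connected graph with countable neighbourhoods is
  countable.\<close>

lemma block_countable:
  assumes G: "graph V E" and con: "connected_graph V E" and fs: "finitely_separable V E"
    and e: "{x, v} \<in> E"
  shows "countable (block E x v)"
proof -
  let ?Y = "block E x v"
  let ?R = "adj (E \<inter> Pow ?Y)"
  have "countable (?R `` {u})" for u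
  proof (cases "u \<in> ?Y")
    case True
    show ?thesis
    proof (rule countable_nbrs_in_component[OF G fs])
      show "u \<in> V" using True block_subset[OF G e] by blast
      show "{u, n} \<in> E" if "n \<in> ?R `` {u}" for n using that unfolding adj_def by blast
      show "reachable {e \<in> E. u \<notin> e} n n'" if n: "n \<in> ?R `` {u}" "n' \<in> ?R `` {u}" for n n'
      proof (rule block_no_cutvertex[OF e])
        show "n \<in> ?Y" "n' \<in> ?Y" using n unfolding adj_def by blast+
        show "u \<noteq> n" "u \<noteq> n'" using n graph_edgeD[OF G] unfolding adj_def by blast+
      qed
    qed
  next
    case False
    then have "?R `` {u} = {}" unfolding adj_def by blast
    then show ?thesis by simp
  qed
  then have "countable (?R\<^sup>* `` {x})" by (rule countable_rtrancl_Image)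
  moreover have "?Y \<subseteq> ?R\<^sup>* `` {x}"
    using block_connected[OF G con e] block_ends(1)[of x E v]
    unfolding connected_graph_def reachable_def by blast
  ultimately show ?thesis using countable_subset by blast
qed

subsection \<open>Gluing trees along blocks\<close>

text \<open>These are the partial solutions for Zorn's lemma. Requiring the cuts to consist of edges
  spanned by the vertices of \<open>T\<close> protects them from edges glued on later. The root is
  inserted so that the empty tree has a vertex.\<close>

definition cut_tree :: "'a set set \<Rightarrow> 'a \<Rightarrow> 'a set set \<Rightarrow> bool" where
  "cut_tree E r T \<longleftrightarrow> T \<subseteq> E \<and> hinged E (insert r (\<Union>T))
     \<and> (\<forall>x\<in>insert r (\<Union>T). reachable T r x)
     \<and> (\<forall>e\<in>T. \<exists>D. finite (cut E D) \<and> cut E D \<subseteq> Pow (insert r (\<Union>T)) \<and> cut E D \<inter> T = {e})"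

lemma cut_treeD:
  assumes "cut_tree E r T"
  shows "T \<subseteq> E" "hinged E (insert r (\<Union>T))" "\<And>x. x \<in> insert r (\<Union>T) \<Longrightarrow> reachable T r x"
    "\<And>e. e \<in> T \<Longrightarrow> \<exists>D. finite (cut E D) \<and> cut E D \<subseteq> Pow (insert r (\<Union>T)) \<and> cut E D \<inter> T = {e}"
  using assms unfolding cut_tree_def by blast+

text \<open>The ends of \<open>f\<close> are joined by a path in \<open>c\<close>, which must cross
  the cut of \<open>f\<close>; but \<open>f\<close> is the only edge of \<open>d\<close> in that
  cut.\<close>

lemma cut_tree_induced:
  assumes c: "cut_tree E r c" and d: "cut_tree E r d" and cd: "c \<subseteq> d"
    and f: "f \<in> d" "f \<subseteq> insert r (\<Union>c)"
  shows "f \<in> c"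
proof (rule ccontr)
  assume fc: "f \<notin> c"
  obtain D where D: "cut E D \<inter> d = {f}" using cut_treeD(4)[OF d f(1)] by blast
  then have "f \<in> cut E D" by blast
  then obtain a b where ab: "f = {a, b}" "a \<in> D" "b \<notin> D" unfolding cut_def by blast
  have "a \<in> insert r (\<Union>c)" "b \<in> insert r (\<Union>c)" using f(2) ab(1) by blast+
  then have re: "reachable c a b"
    using reachable_trans[OF reachable_sym[OF cut_treeD(3)[OF c]] cut_treeD(3)[OF c]] by simp
  have "cut c D = cut E D \<inter> c" by (rule cut_restrict[OF cut_treeD(1)[OF c]])
  also have "\<dots> = (cut E D \<inter> d) \<inter> c" using cd by blast
  also have "\<dots> = {}" using D fc by simp
  finally show False using reachable_cut_free[OF re ab(2)] ab(3) by simp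
qed

text \<open>Any two vertices of the union lie in a common member of the chain, which gives
  hingedness. The cut of an edge is spanned by the vertices of one member, so by
  \<open>cut_tree_induced\<close> larger members add no tree edge to it.\<close>

lemma cut_tree_Union:
  assumes ne: "C \<noteq> {}" and good: "\<And>c. c \<in> C \<Longrightarrow> cut_tree E r c"
    and chain: "\<And>c d. c \<in> C \<Longrightarrow> d \<in> C \<Longrightarrow> c \<subseteq> d \<or> d \<subseteq> c"
  shows "cut_tree E r (\<Union>C)"
proof -
  let ?X = "\<lambda>T. insert r (\<Union>T)"
  have X: "\<exists>c\<in>C. x \<in> ?X c" if "x \<in> ?X (\<Union>C)" for x using that ne by blast
  have Xmono: "?X c \<subseteq> ?X d" if "c \<subseteq> d" for c d :: "'a set set" using that by blast
  have "\<Union>C \<subseteq> E" using cut_treeD(1)[OF good] by blast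
  moreover have "hinged E (?X (\<Union>C))"
    unfolding hinged_def
  proof (intro ballI allI impI notI)
    fix x z x' assume x: "x \<in> ?X (\<Union>C)" and z: "z \<notin> ?X (\<Union>C)" and e: "{x, z} \<in> E"
      and x': "x' \<in> ?X (\<Union>C)" "x' \<noteq> x" and re: "reachable {e \<in> E. x \<notin> e} z x'"
    obtain c d where cd: "c \<in> C" "x \<in> ?X c" "d \<in> C" "x' \<in> ?X d" using X[OF x] X[OF x'(1)] by blast
    obtain b where b: "b \<in> C" "x \<in> ?X b" "x' \<in> ?X b"
      using chain[OF cd(1,3)]
    proof
      assume "c \<subseteq> d" then show thesis using that[OF cd(3)] cd Xmono by blast
    next
      assume "d \<subseteq> c" then show thesis using that[OF cd(1)] cd Xmono by blast
    qed
    have "z \<notin> ?X b" using z b(1) by blast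
    then show False using hingedD[OF cut_treeD(2)[OF good[OF b(1)]] b(2) _ e b(3) x'(2)] re by blast
  qed
  moreover have "\<forall>x\<in>?X (\<Union>C). reachable (\<Union>C) r x"
  proof
    fix x assume "x \<in> ?X (\<Union>C)"
    then obtain c where c: "c \<in> C" "x \<in> ?X c" using X by blast
    show "reachable (\<Union>C) r x"
      by (rule reachable_mono[OF cut_treeD(3)[OF good[OF c(1)] c(2)]]) (use c in blast)
  qed
  moreover have "\<forall>e\<in>\<Union>C. \<exists>D. finite (cut E D) \<and> cut E D \<subseteq> Pow (?X (\<Union>C)) \<and> cut E D \<inter> \<Union>C = {e}"
  proof
    fix e assume "e \<in> \<Union>C"
    then obtain c where c: "c \<in> C" "e \<in> c" by blast
    obtain D where D: "finite (cut E D)" "cut E D \<subseteq> Pow (?X c)" "cut E D \<inter> c = {e}"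
      using cut_treeD(4)[OF good[OF c(1)] c(2)] by blast
    have "f = e" if f: "f \<in> cut E D" "f \<in> d" "d \<in> C" for f d
    proof -
      have "f \<in> c"
        using chain[OF c(1) f(3)]
      proof
        assume "c \<subseteq> d"
        then show ?thesis
          using cut_tree_induced[OF good[OF c(1)] good[OF f(3)] _ f(2)] D(2) f(1) by blast
      qed (use f in blast)
      then show ?thesis using D(3) f(1) by blast
    qed
    then have "cut E D \<inter> \<Union>C = {e}" using D(3) c by blast
    moreover have "cut E D \<subseteq> Pow (?X (\<Union>C))" using D(2) c(1) by blast
    ultimately show "\<exists>D. finite (cut E D) \<and> cut E D \<subseteq> Pow (?X (\<Union>C)) \<and> cut E D \<inter> \<Union>C = {e}"
      using D(1) by blast
  qed
  ultimately show ?thesis unfolding cut_tree_def by blast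
qed

text \<open>The countable block of \<open>xv\<close> receives a tree \<open>S\<close> rooted at
  \<open>x\<close>. Since \<open>?X\<close> and the block share only \<open>x\<close>, no edge is
  spanned by both, so the cuts belonging to one tree do not meet the other.\<close>

lemma cut_tree_extend:
  assumes G: "graph V E" and con: "connected_graph V E" and fs: "finitely_separable V E"
    and T: "cut_tree E r T" and x: "x \<in> insert r (\<Union>T)" and v: "v \<notin> insert r (\<Union>T)"
    and e: "{x, v} \<in> E"
  shows "\<exists>T'. cut_tree E r T' \<and> T \<subset> T'"
proof -
  let ?X = "insert r (\<Union>T)" and ?Y = "block E x v"
  let ?EY = "E \<inter> Pow ?Y"
  note T1 = cut_treeD[OF T]
  have YV: "?Y \<subseteq> V" by (rule block_subset[OF G e])
  have xY: "x \<in> ?Y" and vY: "v \<in> ?Y" by (rule block_ends)+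
  have hY: "hinged E ?Y" by (rule block_hinged[OF e])
  \<comment> \<open>A second common vertex would be reachable from \<open>v\<close> avoiding
    \<open>x\<close>, contradicting that \<open>?X\<close> is hinged.\<close>
  have XY: "z = x" if z: "z \<in> ?X" "z \<in> ?Y" for z
  proof (rule ccontr)
    assume zx: "z \<noteq> x"
    have "x \<noteq> v" using x v by blast
    then have "reachable {e \<in> E. x \<notin> e} v z" using block_no_cutvertex[OF e vY z(2)] zx by blast
    then show False using hingedD[OF T1(2) x v e z(1) zx] by blast
  qed
  have "finitely_separable ?Y ?EY" by (rule finitely_separable_restrict[OF fs YV]) blast
  then have "\<exists>S\<subseteq>?EY. (\<forall>y\<in>?Y. reachable S x y) \<and>
      (\<forall>e\<in>S. \<exists>D. finite (cut ?EY D) \<and> cut ?EY D \<inter> S = {e})"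
    using countable_tree_with_cuts[OF graph_restrict[OF G] block_connected[OF G con e] _
        block_countable[OF G con fs e] xY] by simp
  then obtain S where S: "S \<subseteq> ?EY" "\<And>y. y \<in> ?Y \<Longrightarrow> reachable S x y"
    "\<And>e. e \<in> S \<Longrightarrow> \<exists>D. finite (cut ?EY D) \<and> cut ?EY D \<inter> S = {e}"
    by (elim exE conjE) (simp add: that)
  let ?T = "T \<union> S"
  have YS: "?Y \<subseteq> insert x (\<Union>S)"
    using reachable_in_Union[OF S(2)] by blast
  have X': "insert r (\<Union>?T) = ?X \<union> ?Y"
  proof -
    have "\<Union>S \<subseteq> ?Y" using S(1) by blast
    then show ?thesis using YS x by blast
  qed
  have disj: "\<not> f \<subseteq> ?X \<or> \<not> f \<subseteq> ?Y" if f: "f \<in> E" for f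
  proof -
    obtain a b where ab: "f = {a, b}" "a \<noteq> b" using graph_edgeE[OF G f] .
    then show ?thesis using XY[of a] XY[of b] by (simp only: insert_subset) blast
  qed
  have TX: "f \<subseteq> ?X" if "f \<in> T" for f using that by blast
  have SY: "f \<subseteq> ?Y" if "f \<in> S" for f using that S(1) by blast
  have "hinged E (?X \<union> ?Y)"
    unfolding hinged_def
  proof (intro ballI allI impI notI)
    fix u z u' assume u: "u \<in> ?X \<union> ?Y" and z: "z \<notin> ?X \<union> ?Y" and uz: "{u, z} \<in> E"
      and u': "u' \<in> ?X \<union> ?Y" "u' \<noteq> u" and re: "reachable {e \<in> E. u \<notin> e} z u'"
    have zX: "z \<notin> ?X" and zY: "z \<notin> ?Y" using z by blast+
    have noX: "\<not> reachable {e \<in> E. u \<notin> e} z q" if "u \<in> ?X" "q \<in> ?X" "q \<noteq> u" for q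
      using hingedD[OF T1(2) that(1) zX uz that(2,3)] .
    have noY: "\<not> reachable {e \<in> E. u \<notin> e} z q" if "u \<in> ?Y" "q \<in> ?Y" "q \<noteq> u" for q
      using hingedD[OF hY that(1) zY uz that(2,3)] .
    \<comment> \<open>In the mixed cases \<open>u'\<close> is linked to \<open>x\<close> avoiding
      \<open>u\<close>, through the block in the third and through \<open>T\<close> in the fourth,
      so that \<open>x\<close> can replace \<open>u'\<close>.\<close>
    consider "u \<in> ?X" "u' \<in> ?X" | "u \<in> ?Y" "u' \<in> ?Y" | "u \<in> ?X" "u \<notin> ?Y" "u' \<in> ?Y"
      | "u \<in> ?Y" "u \<notin> ?X" "u' \<in> ?X"
      using u u'(1) by blast
    then show False
    proof cases
      case 1 then show False using noX u'(2) re by blast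
    next
      case 2 then show False using noY u'(2) re by blast
    next
      case 3
      have ux: "x \<noteq> u" using 3 xY by blast
      have "reachable {e \<in> E. u \<notin> e} u' x"
        by (rule block_no_cutvertex[OF e 3(3) xY]) (use u'(2) ux in auto)
      then show False using noX[OF 3(1) x ux] reachable_trans[OF re] by blast
    next
      case 4
      have ux: "x \<noteq> u" using 4 x by blast
      have "reachable T u' x"
        using reachable_trans[OF reachable_sym[OF T1(3)[OF 4(3)]] T1(3)[OF x]] .
      then have "reachable {e \<in> E. u \<notin> e} u' x"
        by (rule reachable_mono) (use T1(1) 4(2) in blast)
      then show False using noY[OF 4(1) xY ux] reachable_trans[OF re] by blast
    qed
  qed
  moreover have "\<forall>y\<in>?X \<union> ?Y. reachable ?T r y"
  proof
    have X: "reachable ?T r y" if "y \<in> ?X" for y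
      by (rule reachable_mono[OF T1(3)[OF that]]) blast
    fix y assume "y \<in> ?X \<union> ?Y"
    then show "reachable ?T r y"
    proof
      assume "y \<in> ?Y"
      then have "reachable ?T x y" by (rule reachable_mono[OF S(2)]) blast
      then show ?thesis by (rule reachable_trans[OF X[OF x]])
    qed (rule X)
  qed
  moreover have "\<forall>f\<in>?T. \<exists>D. finite (cut E D) \<and> cut E D \<subseteq> Pow (?X \<union> ?Y) \<and> cut E D \<inter> ?T = {f}"
  proof
    fix f assume "f \<in> ?T"
    then show "\<exists>D. finite (cut E D) \<and> cut E D \<subseteq> Pow (?X \<union> ?Y) \<and> cut E D \<inter> ?T = {f}"
    proof
      assume f: "f \<in> T"
      obtain D where D: "finite (cut E D)" "cut E D \<subseteq> Pow ?X" "cut E D \<inter> T = {f}"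
        using T1(4)[OF f] by blast
      have "cut E D \<inter> S = {}"
      proof (rule ccontr)
        assume "cut E D \<inter> S \<noteq> {}"
        then obtain g where g: "g \<in> cut E D" "g \<in> S" by blast
        have "g \<in> E" using S(1) g(2) by blast
        moreover have "g \<subseteq> ?X" using D(2) g(1) by (meson PowD subsetD)
        ultimately show False using disj SY[OF g(2)] by blast
      qed
      then have "cut E D \<inter> ?T = {f}" using D(3) by (simp add: Int_Un_distrib)
      moreover have "cut E D \<subseteq> Pow (?X \<union> ?Y)"
        using D(2) by (rule order_trans) (rule Pow_mono[OF Un_upper1])
      ultimately show ?thesis using D(1) by (intro exI[of _ D]) simp
    next
      assume f: "f \<in> S"
      obtain A where A: "finite (cut ?EY A)" "cut ?EY A \<inter> S = {f}" using S(3)[OF f] by blast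
      obtain D where D: "cut E D = cut ?EY A" using hinged_lift_cut[OF hY] by blast
      have DY: "cut E D \<subseteq> Pow ?Y" unfolding D by (auto simp: cut_def)
      have "cut E D \<inter> T = {}"
      proof (rule ccontr)
        assume "cut E D \<inter> T \<noteq> {}"
        then obtain g where g: "g \<in> cut E D" "g \<in> T" by blast
        have "g \<in> E" using T1(1) g(2) by blast
        moreover have "g \<subseteq> ?Y" using DY g(1) by (meson PowD subsetD)
        ultimately show False using disj TX[OF g(2)] by blast
      qed
      then have "cut E D \<inter> ?T = {f}" using A(2) D by (simp add: Int_Un_distrib)
      moreover have "cut E D \<subseteq> Pow (?X \<union> ?Y)"
        using DY by (rule order_trans) (rule Pow_mono[OF Un_upper2])
      ultimately show ?thesis using A(1) D by (intro exI[of _ D]) simp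
    qed
  qed
  moreover have "?T \<subseteq> E" using T1(1) S(1) by blast
  ultimately have "cut_tree E r ?T" unfolding cut_tree_def X' by (intro conjI)
  moreover have "T \<subset> ?T"
  proof -
    have "insert r (\<Union>?T) \<noteq> ?X" using X' vY v by blast
    then have "?T \<noteq> T" by metis
    then show ?thesis by blast
  qed
  ultimately show ?thesis by blast
qed

text \<open>An edge leaving the vertex set of a maximal \<open>cut_tree\<close> would allow an
  extension, so by connectedness that tree spans \<open>V\<close>.\<close>

lemma finitely_separating_tree_exists:
  assumes G: "graph V E" and con: "connected_graph V E" and fs: "finitely_separable V E"
  shows "\<exists>T. spanning_tree V E T \<and> finitely_separating V E T"
proof -
  obtain r where r: "r \<in> V" using con unfolding connected_graph_def by blast
  have base: "cut_tree E r {}" unfolding cut_tree_def hinged_def by simp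
  have "\<exists>M\<in>{T. cut_tree E r T}. \<forall>T\<in>{T. cut_tree E r T}. M \<subseteq> T \<longrightarrow> T = M"
  proof (rule subset_Zorn_nonempty)
    show "{T. cut_tree E r T} \<noteq> {}" using base by blast
    fix C assume ne: "C \<noteq> {}" and C: "subset.chain {T. cut_tree E r T} C"
    have "C \<subseteq> {T. cut_tree E r T}" "\<forall>c\<in>C. \<forall>d\<in>C. c \<subseteq> d \<or> d \<subseteq> c"
      using C unfolding subset_chain_def by blast+
    then have "cut_tree E r (\<Union>C)" using cut_tree_Union[OF ne, of E r] by blast
    then show "\<Union>C \<in> {T. cut_tree E r T}" by simp
  qed
  then obtain M where M: "cut_tree E r M" and max: "\<And>T. cut_tree E r T \<Longrightarrow> M \<subseteq> T \<Longrightarrow> T = M"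
    by blast
  let ?X = "insert r (\<Union>M)"
  have "cut E ?X = {}"
  proof (rule ccontr)
    assume "cut E ?X \<noteq> {}"
    then obtain e where "e \<in> cut E ?X" unfolding ex_in_conv[symmetric] ..
    then obtain x v where xv: "{x, v} \<in> E" "x \<in> ?X" "v \<notin> ?X"
      unfolding cut_def mem_Collect_eq by metis
    obtain T where "cut_tree E r T" "M \<subset> T"
      using cut_tree_extend[OF G con fs M xv(2,3,1)] by (elim exE conjE)
    then show False using max by (metis less_imp_le psubsetE)
  qed
  then have VX: "v \<in> ?X" if "v \<in> V" for v
    using reachable_cut_free[of E r v ?X] con r that unfolding connected_graph_def by blast
  have "spanning_tree V E M \<and> finitely_separating V E M"
  proof (rule spanning_tree_of_cuts[OF G r cut_treeD(1)[OF M]])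
    show "reachable M r v" if "v \<in> V" for v using cut_treeD(3)[OF M VX[OF that]] .
    show "\<exists>D. finite (cut E D) \<and> cut E D \<inter> M = {e}" if "e \<in> M" for e
      using cut_treeD(4)[OF M that] by blast
  qed
  then show ?thesis by blast
qed

theorem theorem2p2:
  fixes V :: "'a set" and E :: "'a set set"
  assumes "graph V E" and "connected_graph V E"
  shows "finitely_separable V E \<longleftrightarrow> (\<exists>T. spanning_tree V E T \<and> finitely_separating V E T)"
proof
  show "\<exists>T. spanning_tree V E T \<and> finitely_separating V E T" if "finitely_separable V E"
    by (rule finitely_separating_tree_exists[OF assms that])
  show "finitely_separable V E" if "\<exists>T. spanning_tree V E T \<and> finitely_separating V E T"
    using finitely_separable_of_tree[OF assms(1)] that by blast
qed

end
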